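(* Let $n\ge2$. Suppose $\Omega_1,\ldots,\Omega_n$ are closed subsets of a complete metric space $X$, $\omega_i\in\Omega_i$ $(i=1,\ldots,n)$, and $\varepsilon>0$. If $$d_1(\omega_1,\ldots,\omega_n)<d_1(\Omega_1,\ldots,\Omega_n)+\varepsilon,$$ then, for all numbers $\lambda,\rho>0$, there exist $\hat\omega_i\in\Omega_i\cap B_\lambda(\omega_i)$ $(i=1,\ldots,n-1)$ and $\hat\omega_n\in\Omega_n\cap B_\rho(\omega_n)$ such that (i) $d_1(\hat\omega_1,\ldots,\hat\omega_n)\le d_1(\omega_1,\ldots,\omega_n)$; (ii) $d_1\big(\Omega_1\cap B_{\xi\lambda}(\hat\omega_1),\ldots,\Omega_{n-1}\cap B_{\xi\lambda}(\hat\omega_{n-1}),\,\Omega_n\cap B_{\xi\rho}(\hat\omega_n)\big)+\xi\varepsilon>d_1(\hat\omega_1,\ldots,\hat\omega_n)$ for all $\xi>0$.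
   Context: $B_\delta(x)$ is the open ball with centre $x$ and radius $\delta>0$ in the metric space $(X,d)$. For points, $d_1(\omega_1,\ldots,\omega_n):=\max_{1\le i\le n-1}d(\omega_i,\omega_n)$; for sets, $d_1(\Omega_1,\ldots,\Omega_n):=\inf_{\omega_1\in\Omega_1,\ldots,\omega_n\in\Omega_n}d_1(\omega_1,\ldots,\omega_n)$. *)

theory Defs
  imports "HOL-Analysis.Analysis"
begin

text \<open>
  An $n$-tuple is a function on \<^typ>\<open>nat\<close> of which only the values at $1, \dots, n$ matter.
\<close>

text \<open>The maximum is over a nonempty set when $n \ge 2$.\<close>

definition d1 :: "nat \<Rightarrow> (nat \<Rightarrow> 'a::metric_space) \<Rightarrow> real" where
  "d1 n \<omega> = (MAX i\<in>{1..n-1}. dist (\<omega> i) (\<omega> n))"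

text \<open>
  The infimum is real-valued, so it is only meaningful when $\Omega_1, \dots, \Omega_n$ are all
  nonempty. For $n \ge 2$ the values of \<^const>\<open>d1\<close> are bounded below by 0.
\<close>

definition d1_sets :: "nat \<Rightarrow> (nat \<Rightarrow> 'a::metric_space set) \<Rightarrow> real" where
  "d1_sets n \<Omega> = (INF \<omega>\<in>(\<Pi> i\<in>{1..n}. \<Omega> i). d1 n \<omega>)"

end

theory Submission
  imports Defs
begin

text \<open>
  On $\Omega_1 \times \dots \times \Omega_n$ take the maximum of $d(u_i, v_i) / \lambda$ for $i < n$
  and $d(u_n, v_n) / \rho$ as the distance, so that the products of balls with radii $\xi\lambda$ and
  $\xi\rho$ are the balls of radius $\xi$. Ekeland's variational principle for $d_1$, with a slope
  $\varepsilon'$ strictly between $d_1(\omega) - d_1(\Omega)$ and $\varepsilon$, yields a point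
  $\hat\omega$ with $d_1(\hat\omega) + \varepsilon' d(\hat\omega, \omega) \le d_1(\omega)$, hence at
  distance less than 1 from $\omega$, and with
  $d_1(\hat\omega) \le d_1(v) + \varepsilon' d(\hat\omega, v)$ for all $v$. Taking
  $\varepsilon' < \varepsilon$ keeps the second inequality strict after passing to the infimum.
\<close>

section \<open>Ekeland's variational principle in a complete metric space\<close>

theorem (in Metric_space) Ekeland_variational_principle:
  fixes f :: "'a \<Rightarrow> real"
  assumes complete: mcomplete
    and lsc: "\<And>c. closedin mtopology {x \<in> M. f x \<le> c}"
    and bdd: "\<And>x. x \<in> M \<Longrightarrow> b \<le> f x"
    and "x0 \<in> M" and "0 < e"
  obtains x where "x \<in> M" "f x + e * d x0 x \<le> f x0"
    "\<And>y. y \<in> M \<Longrightarrow> y \<noteq> x \<Longrightarrow> f x < f y + e * d x y"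
proof -
  \<comment> \<open>\<open>S x\<close> collects the points below \<open>x\<close> in the partial
    order where a move from \<open>x\<close> to \<open>y\<close> is allowed if the decrease of
    \<open>f\<close> pays at least \<open>e * d x y\<close>. The point sought is a minimal element
    of this order below \<open>x0\<close>: a member of \<open>S x0\<close> whose own set
    \<open>S x\<close> is a singleton.\<close>
  define S where "S x = {y \<in> M. f y + e * d x y \<le> f x}" for x
  have S_refl: "x \<in> S x" if "x \<in> M" for x
    using that by (simp add: S_def)
  have S_trans: "z \<in> S x" if "x \<in> M" "y \<in> S x" "z \<in> S y" for x y z
  proof -
    have "e * d x z \<le> e * d x y + e * d y z"
      using that \<open>0 < e\<close> triangle[of x y z] by (simp add: S_def flip: distrib_left)
    then show ?thesis
      using that by (auto simp: S_def)
  qed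
  have S_le: "f y \<le> f x" if "y \<in> S x" for x y
  proof -
    have "0 \<le> e * d x y"
      using \<open>0 < e\<close> by simp
    then show ?thesis
      using that by (simp add: S_def)
  qed
  \<comment> \<open>The infimum of \<open>f\<close> over \<open>S x\<close> need not be attained, so
    each step of the descent settles for a near-minimizer. The tolerances \<open>(1/2)^k\<close>
    matter only in that they tend to 0.\<close>
  have step: "\<exists>y\<in>S x. \<forall>z\<in>S x. f y - (1/2)^k \<le> f z" if "x \<in> M" for x and k :: nat
  proof -
    have bb: "bdd_below (f ` S x)"
      using bdd by (auto simp: S_def intro!: bdd_belowI2[of _ b])
    have "S x \<noteq> {}"
      using S_refl that by blast
    moreover have "(INF z\<in>S x. f z) < (INF z\<in>S x. f z) + (1/2)^k"
      by simp
    ultimately obtain y where "y \<in> S x" "f y < (INF z\<in>S x. f z) + (1/2)^k"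
      using cINF_less_iff bb by meson
    moreover have "(INF z\<in>S x. f z) \<le> f z" if "z \<in> S x" for z
      using cINF_lower[OF bb that] .
    ultimately show ?thesis
      by (smt (verit))
  qed
  \<comment> \<open>The clause about \<open>k = 0\<close> in the invariant anchors the dependent
    choice at \<open>x0\<close>.\<close>
  have "\<exists>s. \<forall>k. (s k \<in> M \<and> (k = 0 \<longrightarrow> s k = x0)) \<and>
      s (Suc k) \<in> S (s k) \<and> (\<forall>z\<in>S (s k). f (s (Suc k)) - (1/2)^k \<le> f z)"
  proof (rule dependent_nat_choice)
    show "\<exists>x. x \<in> M \<and> ((0::nat) = 0 \<longrightarrow> x = x0)"
      using \<open>x0 \<in> M\<close> by blast
    fix x and k :: nat
    assume "x \<in> M \<and> (k = 0 \<longrightarrow> x = x0)"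
    then show "\<exists>y. (y \<in> M \<and> (Suc k = 0 \<longrightarrow> y = x0)) \<and>
        y \<in> S x \<and> (\<forall>z\<in>S x. f y - (1/2)^k \<le> f z)"
      using step[of x k] by (auto simp: S_def)
  qed
  then obtain s where sM: "\<And>k. s k \<in> M" and s0: "s 0 = x0"
    and sS: "\<And>k. s (Suc k) \<in> S (s k)"
    and smin: "\<And>k z. z \<in> S (s k) \<Longrightarrow> f (s (Suc k)) - (1/2)^k \<le> f z"
    by blast
  have mono: "s k \<in> S (s j)" if "j \<le> k" for j k
    using that
  proof (induction k rule: dec_induct)
    case base
    show ?case using S_refl sM by blast
  next
    case (step k)
    show ?case using S_trans[OF sM step.IH sS] .
  qed
  have "decseq (\<lambda>k. f (s k))"
    using mono S_le by (auto simp: decseq_def)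
  then obtain L where "(\<lambda>k. f (s k)) \<longlonglongrightarrow> L"
    using decseq_convergent[of "\<lambda>k. f (s k)" b] bdd sM by blast
  then have Cauchy_f: "Cauchy (\<lambda>k. f (s k))"
    using LIMSEQ_imp_Cauchy by blast
  have "MCauchy s"
    unfolding MCauchy_def
  proof (intro conjI allI impI)
    show "range s \<subseteq> M"
      using sM by blast
    fix r :: real
    assume "0 < r"
    then obtain N where N: "\<And>j k. j \<ge> N \<Longrightarrow> k \<ge> N \<Longrightarrow> \<bar>f (s j) - f (s k)\<bar> < e * r"
      using metric_CauchyD[OF Cauchy_f, of "e * r"] \<open>0 < e\<close> by (auto simp: dist_real_def)
    \<comment> \<open>For \<open>j \<le> k\<close>, membership in \<open>S (s j)\<close> gives
      \<open>e * d (s j) (s k) \<le> f (s j) - f (s k)\<close>. So the Cauchy property passes from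
      the convergent values to the points.\<close>
    have *: "d (s j) (s k) < r" if "N \<le> j" "j \<le> k" for j k
    proof -
      have "e * d (s j) (s k) < e * r"
        using mono[OF \<open>j \<le> k\<close>] N[of j k] that by (simp add: S_def abs_less_iff)
      then show ?thesis
        using \<open>0 < e\<close> by simp
    qed
    have "d (s j) (s k) < r" if "N \<le> j" "N \<le> k" for j k
      using *[of j k] *[of k j] that commute by (metis nle_le)
    then show "\<exists>N. \<forall>j k. N \<le> j \<longrightarrow> N \<le> k \<longrightarrow> d (s j) (s k) < r"
      by blast
  qed
  then obtain x where lim: "limitin mtopology s x sequentially"
    using complete mcomplete_def by blast
  then have "x \<in> M"
    by (simp add: limit_metric_sequentially)
  have xS: "x \<in> S (s j)" for j
  proof -
    \<comment> \<open>Closedness is available for sublevel sets of \<open>f\<close>, not for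
      \<open>S (s j)\<close>. The slack \<open>r\<close> absorbs the replacement of
      \<open>d (s j) (s k)\<close> by \<open>d (s j) x\<close>, so that the level no longer depends
      on \<open>k\<close> and the limit can be taken.\<close>
    have "f x + e * d (s j) x \<le> f (s j) + r" if "0 < r" for r
    proof -
      have "\<forall>\<^sub>F k in sequentially. s k \<in> M \<and> d (s k) x < r / e"
        using lim \<open>0 < r\<close> \<open>0 < e\<close> by (simp add: limitin_metric)
      then have "\<forall>\<^sub>F k in sequentially. s k \<in> {y \<in> M. f y \<le> f (s j) - e * d (s j) x + r}"
        using eventually_ge_at_top[of j]
      proof eventually_elim
        case (elim k)
        have "d (s j) x \<le> d (s j) (s k) + r / e"
          using triangle[OF sM sM \<open>x \<in> M\<close>, of j k] elim by simp
        then have "e * d (s j) x \<le> e * (d (s j) (s k) + r / e)"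
          using \<open>0 < e\<close> by simp
        then have "e * d (s j) x \<le> e * d (s j) (s k) + r"
          using \<open>0 < e\<close> by (simp add: distrib_left)
        then show ?case
          using mono[OF \<open>j \<le> k\<close>] by (simp add: S_def)
      qed
      then have "x \<in> {y \<in> M. f y \<le> f (s j) - e * d (s j) x + r}"
        using limitin_closedin[OF lim lsc] by simp
      then show ?thesis by simp
    qed
    then have "f x + e * d (s j) x \<le> f (s j)"
      by (rule field_le_epsilon)
    then show ?thesis
      using \<open>x \<in> M\<close> by (simp add: S_def)
  qed
  show thesis
  proof
    show "x \<in> M" by fact
    show "f x + e * d x0 x \<le> f x0"
      using xS[of 0] s0 by (simp add: S_def)
    fix y
    assume "y \<in> M" "y \<noteq> x"
    show "f x < f y + e * d x y"
    proof (rule ccontr)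
      assume not_less: "\<not> ?thesis"
      then have "y \<in> S x"
        using \<open>y \<in> M\<close> by (simp add: S_def)
      \<comment> \<open>By transitivity \<open>y\<close> belongs to every \<open>S (s k)\<close>, so
        it competed in each near-minimization. Its value is therefore at least \<open>f x\<close> in
        the limit, whereas \<open>y \<in> S x\<close> with \<open>y \<noteq> x\<close> forces a
        strictly smaller value.\<close>
      have "f x - (1/2)^k \<le> f y" for k
        using smin[OF S_trans[OF sM xS \<open>y \<in> S x\<close>], of k] S_le[OF xS, of "Suc k"] by linarith
      moreover have "(\<lambda>k. f x - (1/2)^k) \<longlonglongrightarrow> f x - 0"
        by (intro tendsto_intros) simp
      ultimately have "f x \<le> f y"
        using LIMSEQ_le_const2 by fastforce
      moreover have "0 < e * d x y"
        using \<open>0 < e\<close> \<open>x \<in> M\<close> \<open>y \<in> M\<close> \<open>y \<noteq> x\<close> by simp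
      ultimately show False
        using not_less by linarith
    qed
  qed
qed

section \<open>The weighted maximum metric on a finite product\<close>

definition weighted_dist ::
    "'i set \<Rightarrow> ('i \<Rightarrow> real) \<Rightarrow> ('i \<Rightarrow> 'a::metric_space) \<Rightarrow> ('i \<Rightarrow> 'a) \<Rightarrow> real" where
  "weighted_dist I w u v = (MAX i\<in>I. dist (u i) (v i) / w i)"

context
  fixes I :: "'i set" and w :: "'i \<Rightarrow> real"
  assumes fin: "finite I" and ne: "I \<noteq> {}" and pos: "\<And>i. i \<in> I \<Longrightarrow> 0 < w i"
begin

lemma weighted_dist_le_iff:
  "weighted_dist I w u v \<le> r \<longleftrightarrow> (\<forall>i\<in>I. dist (u i) (v i) \<le> r * w i)"
  using fin ne pos by (simp add: weighted_dist_def pos_divide_le_eq)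

lemma weighted_dist_less_iff:
  "weighted_dist I w u v < r \<longleftrightarrow> (\<forall>i\<in>I. dist (u i) (v i) < r * w i)"
  using fin ne pos by (simp add: weighted_dist_def pos_divide_less_eq)

lemma dist_le_weighted_dist:
  "i \<in> I \<Longrightarrow> dist (u i) (v i) \<le> weighted_dist I w u v * w i"
  using weighted_dist_le_iff by blast

text \<open>The distance sees only coordinates in \<open>I\<close>. Extensional functions make
  distance 0 imply equality, which is why the carrier is a \<open>Pi\<^sub>E\<close>.\<close>

lemma Metric_space_weighted_dist: "Metric_space (Pi\<^sub>E I \<Omega>) (weighted_dist I w)"
proof
  fix u v :: "'i \<Rightarrow> 'a"
  obtain i where "i \<in> I"
    using ne by blast
  have "0 \<le> weighted_dist I w u v * w i"
    using dist_le_weighted_dist[OF \<open>i \<in> I\<close>, of u v] zero_le_dist order_trans by blast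
  then show nonneg: "0 \<le> weighted_dist I w u v"
    using pos[OF \<open>i \<in> I\<close>] by (simp add: zero_le_mult_iff)
  show "weighted_dist I w u v = weighted_dist I w v u"
    by (simp add: weighted_dist_def dist_commute)
  assume "u \<in> Pi\<^sub>E I \<Omega>" "v \<in> Pi\<^sub>E I \<Omega>"
  then show "weighted_dist I w u v = 0 \<longleftrightarrow> u = v"
    using nonneg weighted_dist_le_iff[of u v 0] PiE_ext[of u I \<Omega> v] by auto
next
  fix u v x :: "'i \<Rightarrow> 'a"
  have "dist (u i) (x i) \<le> (weighted_dist I w u v + weighted_dist I w v x) * w i"
    if "i \<in> I" for i
    using dist_triangle[of "u i" "x i" "v i"] dist_le_weighted_dist[OF that, of u v]
      dist_le_weighted_dist[OF that, of v x]
    unfolding distrib_right by linarith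
  then show "weighted_dist I w u x \<le> weighted_dist I w u v + weighted_dist I w v x"
    by (simp add: weighted_dist_le_iff)
qed

text \<open>Since \<open>I\<close> is finite, "eventually" commutes with the quantifier over
  coordinates, and the positive weights only rescale the radius. This reduces completeness and
  closedness on the product to single coordinates.\<close>

lemma limitin_weighted_dist_iff:
  assumes "range s \<subseteq> Pi\<^sub>E I \<Omega>"
  shows "limitin (Metric_space.mtopology (Pi\<^sub>E I \<Omega>) (weighted_dist I w)) s u sequentially \<longleftrightarrow>
    u \<in> Pi\<^sub>E I \<Omega> \<and> (\<forall>i\<in>I. (\<lambda>k. s k i) \<longlonglongrightarrow> u i)"
proof -
  have "(\<forall>r>0. \<forall>\<^sub>F k in sequentially. weighted_dist I w (s k) u < r) \<longleftrightarrow>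
      (\<forall>r>0. \<forall>i\<in>I. \<forall>\<^sub>F k in sequentially. dist (s k i) (u i) < r * w i)"
    using fin by (simp add: weighted_dist_less_iff eventually_ball_finite_distrib)
  also have "\<dots> \<longleftrightarrow> (\<forall>i\<in>I. (\<lambda>k. s k i) \<longlonglongrightarrow> u i)"
  proof -
    have "(\<forall>r>0. \<forall>\<^sub>F k in sequentially. dist (s k i) (u i) < r * w i) \<longleftrightarrow>
        (\<lambda>k. s k i) \<longlonglongrightarrow> u i" if "i \<in> I" for i
    proof
      assume A: "\<forall>r>0. \<forall>\<^sub>F k in sequentially. dist (s k i) (u i) < r * w i"
      show "(\<lambda>k. s k i) \<longlonglongrightarrow> u i"
      proof (rule tendstoI)
        fix r :: real
        assume "0 < r"
        then show "\<forall>\<^sub>F k in sequentially. dist (s k i) (u i) < r"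
          using A[rule_format, of "r / w i"] pos[OF that] by simp
      qed
    next
      assume "(\<lambda>k. s k i) \<longlonglongrightarrow> u i"
      then show "\<forall>r>0. \<forall>\<^sub>F k in sequentially. dist (s k i) (u i) < r * w i"
        using pos[OF that] by (simp add: tendstoD)
    qed
    then show ?thesis by blast
  qed
  finally show ?thesis
    using assms
    by (simp add: Metric_space.limitin_metric[OF Metric_space_weighted_dist] range_subsetD)
qed

end

text \<open>A Cauchy sequence is Cauchy in each coordinate, and each coordinate limit stays in the
  closed set \<open>\<Omega> i\<close>.\<close>

lemma mcomplete_weighted_dist:
  fixes \<Omega> :: "'i \<Rightarrow> 'a::complete_space set"
  assumes fin: "finite I" and ne: "I \<noteq> {}" and pos: "\<And>i. i \<in> I \<Longrightarrow> 0 < w i"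
    and closed: "\<And>i. i \<in> I \<Longrightarrow> closed (\<Omega> i)"
  shows "Metric_space.mcomplete (Pi\<^sub>E I \<Omega>) (weighted_dist I w)"
proof -
  interpret Metric_space "Pi\<^sub>E I \<Omega>" "weighted_dist I w"
    using fin ne pos by (rule Metric_space_weighted_dist)
  show ?thesis
    unfolding mcomplete_def
  proof (intro allI impI)
    fix s
    assume "MCauchy s"
    then have s: "range s \<subseteq> Pi\<^sub>E I \<Omega>"
      and cauchy: "\<And>r. 0 < r \<Longrightarrow> \<exists>N. \<forall>j k. N \<le> j \<longrightarrow> N \<le> k \<longrightarrow> weighted_dist I w (s j) (s k) < r"
      by (auto simp: MCauchy_def)
    have "\<exists>l\<in>\<Omega> i. (\<lambda>k. s k i) \<longlonglongrightarrow> l" if "i \<in> I" for i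
    proof -
      have "Cauchy (\<lambda>k. s k i)"
      proof (rule metric_CauchyI)
        fix r :: real
        assume "0 < r"
        then have "0 < r / w i"
          using pos[OF that] by simp
        then obtain N where "\<forall>j\<ge>N. \<forall>k\<ge>N. weighted_dist I w (s j) (s k) < r / w i"
          using cauchy by blast
        then have "\<forall>j\<ge>N. \<forall>k\<ge>N. dist (s j i) (s k i) < r / w i * w i"
          using weighted_dist_less_iff[of _ w, OF fin ne pos] that by blast
        then show "\<exists>N. \<forall>j\<ge>N. \<forall>k\<ge>N. dist (s j i) (s k i) < r"
          using pos[OF that] by auto
      qed
      then obtain l where l: "(\<lambda>k. s k i) \<longlonglongrightarrow> l"
        by (auto simp: Cauchy_convergent_iff convergent_def)
      have "s k i \<in> \<Omega> i" for k
        using PiE_mem[OF range_subsetD[OF s] that] .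
      then have "l \<in> \<Omega> i"
        using closed_sequentially[OF closed[OF that] _ l] by blast
      then show ?thesis
        using l by blast
    qed
    then obtain l where "\<And>i. i \<in> I \<Longrightarrow> l i \<in> \<Omega> i" "\<And>i. i \<in> I \<Longrightarrow> (\<lambda>k. s k i) \<longlonglongrightarrow> l i"
      by metis
    \<comment> \<open>The coordinate limits are arbitrary outside \<open>I\<close>; restricting puts
      them in the carrier.\<close>
    then have "restrict l I \<in> Pi\<^sub>E I \<Omega> \<and> (\<forall>i\<in>I. (\<lambda>k. s k i) \<longlonglongrightarrow> restrict l I i)"
      by simp
    then show "\<exists>u. limitin mtopology s u sequentially"
      using limitin_weighted_dist_iff[of _ w, OF fin ne pos s] by blast
  qed
qed

section \<open>Elementary bounds for \<open>d1\<close> and \<open>d1_sets\<close>\<close>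

lemma d1_le_iff:
  assumes "2 \<le> n"
  shows "d1 n \<omega> \<le> c \<longleftrightarrow> (\<forall>i\<in>{1..n-1}. dist (\<omega> i) (\<omega> n) \<le> c)"
  using assms by (simp add: d1_def)

lemma d1_nonneg:
  assumes "2 \<le> n"
  shows "0 \<le> d1 n \<omega>"
proof -
  have "0 \<le> dist (\<omega> 1) (\<omega> n)"
    by simp
  also have "\<dots> \<le> d1 n \<omega>"
    using assms d1_le_iff[of n \<omega> "d1 n \<omega>"] by auto
  finally show ?thesis .
qed

text \<open>This allows passing between arbitrary tuples and the extensional ones that form the
  metric space.\<close>

lemma d1_restrict:
  assumes "2 \<le> n"
  shows "d1 n (restrict \<omega> {1..n}) = d1 n \<omega>"
  using assms by (auto simp: d1_def intro!: arg_cong[where f = Max] image_cong)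

lemma d1_sets_le:
  assumes "2 \<le> n" "\<omega> \<in> (\<Pi> i\<in>{1..n}. \<Omega> i)"
  shows "d1_sets n \<Omega> \<le> d1 n \<omega>"
  unfolding d1_sets_def using assms d1_nonneg by (intro cINF_lower bdd_belowI2[of _ 0])

section \<open>Ekeland's principle applied to \<open>d1\<close> on the product of the closed
  sets\<close>

theorem lemma5p1:
  fixes n :: nat
    and \<Omega> :: "nat \<Rightarrow> 'a::complete_space set"
    and \<omega> :: "nat \<Rightarrow> 'a"
    and \<epsilon> :: real
  assumes "n \<ge> 2"
    and "\<And>i. i \<in> {1..n} \<Longrightarrow> closed (\<Omega> i)"
    and "\<And>i. i \<in> {1..n} \<Longrightarrow> \<omega> i \<in> \<Omega> i"
    and "\<epsilon> > 0"
    and "d1 n \<omega> < d1_sets n \<Omega> + \<epsilon>"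
  shows "\<forall>l>0. \<forall>\<rho>>0. \<exists>\<omega>'.
      (\<forall>i\<in>{1..n-1}. \<omega>' i \<in> \<Omega> i \<inter> ball (\<omega> i) l) \<and>
      \<omega>' n \<in> \<Omega> n \<inter> ball (\<omega> n) \<rho> \<and>
      d1 n \<omega>' \<le> d1 n \<omega> \<and>
      (\<forall>\<xi>>0. d1_sets n (\<lambda>i. \<Omega> i \<inter> ball (\<omega>' i) (if i = n then \<xi> * \<rho> else \<xi> * l)) + \<xi> * \<epsilon>
              > d1 n \<omega>')"
proof (intro allI impI)
  fix l \<rho> :: real
  assume "0 < l" "0 < \<rho>"
  define w where "w i = (if i = n then \<rho> else l)" for i
  let ?M = "Pi\<^sub>E {1..n} \<Omega>" and ?D = "weighted_dist {1..n} w"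
  have fin: "finite {1..n}" and ne: "{1..n} \<noteq> {}" and pos: "\<And>i. i \<in> {1..n} \<Longrightarrow> 0 < w i"
    using \<open>n \<ge> 2\<close> \<open>0 < l\<close> \<open>0 < \<rho>\<close> by (auto simp: w_def)
  interpret Metric_space ?M ?D
    using fin ne pos by (rule Metric_space_weighted_dist)
  \<comment> \<open>The bound \<open>d1 n u \<le> c\<close> is a conjunction of bounds on distances
    between coordinates, each preserved under coordinatewise limits.\<close>
  have lsc: "closedin mtopology {u \<in> ?M. d1 n u \<le> c}" for c
    unfolding metric_closedin_iff_sequentially_closed
  proof (intro conjI allI impI)
    fix s u
    assume "range s \<subseteq> {u \<in> ?M. d1 n u \<le> c} \<and> limitin mtopology s u sequentially"
    then have s: "range s \<subseteq> ?M" and le: "\<And>k. d1 n (s k) \<le> c"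
      and "limitin mtopology s u sequentially"
      by auto
    then have "u \<in> ?M" and lim: "\<And>i. i \<in> {1..n} \<Longrightarrow> (\<lambda>k. s k i) \<longlonglongrightarrow> u i"
      using limitin_weighted_dist_iff[of _ w, OF fin ne pos s] by auto
    have "dist (u i) (u n) \<le> c" if "i \<in> {1..n-1}" for i
    proof (rule LIMSEQ_le_const2)
      show "(\<lambda>k. dist (s k i) (s k n)) \<longlonglongrightarrow> dist (u i) (u n)"
        using that \<open>n \<ge> 2\<close> by (intro tendsto_dist lim) auto
      show "\<exists>N. \<forall>k\<ge>N. dist (s k i) (s k n) \<le> c"
        using le that d1_le_iff[OF \<open>n \<ge> 2\<close>] by blast
    qed
    then show "u \<in> {u \<in> ?M. d1 n u \<le> c}"
      using \<open>u \<in> ?M\<close> d1_le_iff[OF \<open>n \<ge> 2\<close>] by blast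
  qed auto
  have Pi: "\<omega> \<in> Pi {1..n} \<Omega>"
    using assms(3) by blast
  obtain e where e: "d1 n \<omega> - d1_sets n \<Omega> < e" "e < \<epsilon>"
    using assms(5) dense[of "d1 n \<omega> - d1_sets n \<Omega>" \<epsilon>] by auto
  \<comment> \<open>The gap \<open>d1 n \<omega> - d1_sets n \<Omega>\<close> is nonnegative because
    \<open>\<omega>\<close> competes in the infimum, and \<open>e\<close> exceeds it.\<close>
  have "0 < e"
    using e d1_sets_le[OF \<open>n \<ge> 2\<close> Pi] by linarith
  have "restrict \<omega> {1..n} \<in> ?M"
    using Pi by simp
  then obtain u where "u \<in> ?M" and u_le: "d1 n u + e * ?D (restrict \<omega> {1..n}) u \<le> d1 n \<omega>"
    and min: "\<And>v. v \<in> ?M \<Longrightarrow> v \<noteq> u \<Longrightarrow> d1 n u < d1 n v + e * ?D u v"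
    using Ekeland_variational_principle[OF mcomplete_weighted_dist[of _ w, OF fin ne pos assms(2)] lsc
        d1_nonneg[OF \<open>n \<ge> 2\<close>] _ \<open>0 < e\<close>] by (metis d1_restrict[OF \<open>n \<ge> 2\<close>])
  have u_Pi: "u \<in> Pi {1..n} \<Omega>"
    using \<open>u \<in> ?M\<close> by (simp add: PiE_def)
  \<comment> \<open>The total decrease of \<open>d1\<close> from \<open>\<omega>\<close> to
    \<open>u\<close> is at most the gap to the infimum, hence below \<open>e\<close>. So
    \<open>u\<close> is within distance 1 of \<open>\<omega>\<close>, which in coordinates means the
    open balls of radii \<open>l\<close> and \<open>\<rho>\<close>.\<close>
  have "e * ?D (restrict \<omega> {1..n}) u < e * 1"
    using u_le e d1_sets_le[OF \<open>n \<ge> 2\<close> u_Pi] by linarith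
  then have "?D (restrict \<omega> {1..n}) u < 1"
    using \<open>0 < e\<close> by simp
  then have near: "\<forall>i\<in>{1..n}. dist (\<omega> i) (u i) < w i"
    using weighted_dist_less_iff[of _ w "restrict \<omega> {1..n}" u 1, OF fin ne pos] by simp
  have strict: "d1 n u < d1_sets n (\<lambda>i. \<Omega> i \<inter> ball (u i) (if i = n then \<xi> * \<rho> else \<xi> * l)) + \<xi> * \<epsilon>"
    if "0 < \<xi>" for \<xi>
  proof -
    let ?B = "\<lambda>i. \<Omega> i \<inter> ball (u i) (if i = n then \<xi> * \<rho> else \<xi> * l)"
    \<comment> \<open>The tuple \<open>u\<close> witnesses that the infimum over \<open>?B\<close>
      runs over a nonempty set; otherwise a lower bound for all its values would say nothing about
      it.\<close>
    have "u \<in> Pi {1..n} ?B"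
      using u_Pi \<open>0 < \<xi>\<close> \<open>0 < l\<close> \<open>0 < \<rho>\<close> by auto
    moreover have "d1 n u - \<xi> * e \<le> d1 n v" if "v \<in> Pi {1..n} ?B" for v
    proof -
      let ?v = "restrict v {1..n}"
      have "?v \<in> ?M"
        using that by auto
      \<comment> \<open>Ekeland's strict inequality excludes \<open>?v = u\<close>; in that case the
        weak inequality holds because the penalty is nonnegative.\<close>
      have "0 \<le> e * ?D u ?v"
        using \<open>0 < e\<close> nonneg by (intro mult_nonneg_nonneg) auto
      then have "d1 n u \<le> d1 n ?v + e * ?D u ?v"
        using min[OF \<open>?v \<in> ?M\<close>] by (cases "?v = u") auto
      then have "d1 n u \<le> d1 n v + e * ?D u ?v"
        unfolding d1_restrict[OF \<open>n \<ge> 2\<close>] .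
      moreover have "?D u ?v < \<xi>"
        using that weighted_dist_less_iff[of _ w u ?v \<xi>, OF fin ne pos]
        by (auto simp: w_def Pi_iff split: if_splits)
      then have "e * ?D u ?v \<le> e * \<xi>"
        using \<open>0 < e\<close> by simp
      ultimately show ?thesis
        by (simp add: mult.commute)
    qed
    ultimately have "d1 n u - \<xi> * e \<le> d1_sets n ?B"
      unfolding d1_sets_def by (intro cINF_greatest) blast+
    moreover have "\<xi> * e < \<xi> * \<epsilon>"
      using \<open>0 < \<xi>\<close> e by simp
    ultimately show ?thesis
      by linarith
  qed
  have u_in: "u i \<in> \<Omega> i \<inter> ball (\<omega> i) (w i)" if "i \<in> {1..n}" for i
    using that u_Pi near by auto
  have "0 \<le> e * ?D (restrict \<omega> {1..n}) u"
    using \<open>0 < e\<close> nonneg by (intro mult_nonneg_nonneg) auto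
  then have "d1 n u \<le> d1 n \<omega>"
    using u_le by linarith
  moreover have "\<forall>i\<in>{1..n-1}. u i \<in> \<Omega> i \<inter> ball (\<omega> i) l"
  proof
    fix i
    assume "i \<in> {1..n-1}"
    then have "i \<in> {1..n}" "w i = l"
      using \<open>n \<ge> 2\<close> by (auto simp: w_def)
    then show "u i \<in> \<Omega> i \<inter> ball (\<omega> i) l"
      using u_in[of i] by simp
  qed
  moreover have "u n \<in> \<Omega> n \<inter> ball (\<omega> n) \<rho>"
    using u_in[of n] \<open>n \<ge> 2\<close> by (simp add: w_def)
  ultimately show "\<exists>\<omega>'. (\<forall>i\<in>{1..n-1}. \<omega>' i \<in> \<Omega> i \<inter> ball (\<omega> i) l) \<and>
      \<omega>' n \<in> \<Omega> n \<inter> ball (\<omega> n) \<rho> \<and> d1 n \<omega>' \<le> d1 n \<omega> \<and>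
      (\<forall>\<xi>>0. d1_sets n (\<lambda>i. \<Omega> i \<inter> ball (\<omega>' i) (if i = n then \<xi> * \<rho> else \<xi> * l)) + \<xi> * \<epsilon>
        > d1 n \<omega>')"
    using strict by blast
qed

end
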